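(* Let $C_n=\langle a\rangle$ be a cyclic group of order $n=p^st$. For $1\leqslant r\leqslant p^s$ and $0\leqslant i\leqslant t-1$, let $\rho_{r,i}$ be the $r$-dimensional matrix representation of $C_n$ over $k$ for which $$\rho_{r,i}(a)=\begin{pmatrix}\xi^i&1&0&\cdots&0&0\\ 0&\xi^i&1&\cdots&0&0\\ 0&0&\xi^i&\cdots&0&0\\ \vdots&\vdots&\vdots&\ddots&\vdots&\vdots\\ 0&0&0&\cdots&\xi^i&1\\ 0&0&0&\cdots&0&\xi^i\end{pmatrix}_{r\times r}$$ is the $r\times r$ upper triangular Jordan block with eigenvalue $\xi^i$. Then the $\rho_{r,i}$, $1\leqslant r\leqslant p^s$, $0\leqslant i\leqslant t-1$, are exactly the $n$ non-isomorphic indecomposable representations of $kC_n$: they are indecomposable, pairwise non-isomorphic, and every finite dimensional indecomposable representation of $kC_n$ is isomorphic to one of them.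
   Context: $k$ is an algebraically closed field of odd characteristic $p$; $n=p^st$ with $s\geqslant 1$ and $p\nmid t$; $\xi\in k$ is a primitive $t$-th root of unity. All modules and representations are finite dimensional over $k$. *)

theory Defs
  imports
    "HOL-Algebra.Generated_Groups"
    "Jordan_Normal_Form.VS_Connect"
    "Jordan_Normal_Form.Jordan_Normal_Form"
begin

locale group_rep = group G + vectorspace K V
  for G :: "('g, 'x) monoid_scheme" (structure)
    and K :: "('k, 'y) ring_scheme"
    and V :: "('k, 'v, 'z) module_scheme"
    and \<rho> :: "'g \<Rightarrow> 'v \<Rightarrow> 'v" +
  assumes act_linear: "g \<in> carrier G \<Longrightarrow> linear_map K V V (\<rho> g)"
    and act_one: "v \<in> carrier V \<Longrightarrow> \<rho> \<one> v = v"
    and act_mult: "\<lbrakk>g \<in> carrier G; h \<in> carrier G; v \<in> carrier V\<rbrakk> \<Longrightarrow> \<rho> (g \<otimes> h) v = \<rho> g (\<rho> h v)"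
begin

definition subrep :: "'v set \<Rightarrow> bool" where
  "subrep W \<longleftrightarrow> VectorSpace.subspace K W V \<and> (\<forall>g\<in>carrier G. \<forall>w\<in>W. \<rho> g w \<in> W)"

definition indecomposable :: bool where
  "indecomposable \<longleftrightarrow> carrier V \<noteq> {\<zero>\<^bsub>V\<^esub>} \<and>
     (\<forall>U W. subrep U \<and> subrep W \<and> U \<inter> W = {\<zero>\<^bsub>V\<^esub>} \<and> subspace_sum U W = carrier V
        \<longrightarrow> U = {\<zero>\<^bsub>V\<^esub>} \<or> W = {\<zero>\<^bsub>V\<^esub>})"

end

definition fin_dim_rep ::
  "('g, 'x) monoid_scheme \<Rightarrow> ('k, 'y) ring_scheme \<Rightarrow> ('k, 'v, 'z) module_scheme
    \<Rightarrow> ('g \<Rightarrow> 'v \<Rightarrow> 'v) \<Rightarrow> bool" where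
  "fin_dim_rep G K V \<rho> \<longleftrightarrow> group_rep G K V \<rho> \<and> vectorspace.fin_dim K V"

definition indecomposable_rep ::
  "('g, 'x) monoid_scheme \<Rightarrow> ('k, 'y) ring_scheme \<Rightarrow> ('k, 'v, 'z) module_scheme
    \<Rightarrow> ('g \<Rightarrow> 'v \<Rightarrow> 'v) \<Rightarrow> bool" where
  "indecomposable_rep G K V \<rho> \<longleftrightarrow> group_rep G K V \<rho> \<and> group_rep.indecomposable G K V \<rho>"

definition rep_isomorphic ::
  "('g, 'x) monoid_scheme \<Rightarrow> ('k, 'y) ring_scheme
    \<Rightarrow> ('k, 'v, 'z) module_scheme \<Rightarrow> ('g \<Rightarrow> 'v \<Rightarrow> 'v)
    \<Rightarrow> ('k, 'w, 'u) module_scheme \<Rightarrow> ('g \<Rightarrow> 'w \<Rightarrow> 'w) \<Rightarrow> bool" where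
  "rep_isomorphic G K V \<rho> W \<sigma> \<longleftrightarrow>
     (\<exists>T. linear_map K V W T \<and> bij_betw T (carrier V) (carrier W) \<and>
          (\<forall>g\<in>carrier G. \<forall>v\<in>carrier V. T (\<rho> g v) = \<sigma> g (T v)))"

definition general_linear :: "'k::field itself \<Rightarrow> nat \<Rightarrow> 'k mat monoid" where
  "general_linear ty r = units_of (ring_mat ty r ())"

text \<open>A matrix representation of degree \<open>r\<close> acts on column vectors of length \<open>r\<close>, that is on
  the space \<^term>\<open>module_vec TYPE('k::field) r\<close>.\<close>

definition mat_action :: "('g \<Rightarrow> 'k::field mat) \<Rightarrow> 'g \<Rightarrow> 'k vec \<Rightarrow> 'k vec" where
  "mat_action \<rho> g v = \<rho> g *\<^sub>v v"

definition primitive_root_of_unity :: "nat \<Rightarrow> 'k::field \<Rightarrow> bool" where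
  "primitive_root_of_unity t \<xi> \<longleftrightarrow> 0 < t \<and> \<xi> ^ t = 1 \<and> (\<forall>m. 0 < m \<and> m < t \<longrightarrow> \<xi> ^ m \<noteq> 1)"

text \<open>The assignment \<open>a\<^sup>m \<mapsto> J\<^sup>m\<close> for the Jordan block \<open>J\<close> of size \<open>r\<close> with eigenvalue \<open>\<xi>\<^sup>i\<close>.
  The least exponent makes this a total function whether or not \<open>J\<close> satisfies the relation
  \<open>J\<^sup>n = 1\<close>; only under that relation is it a homomorphism.\<close>

definition jordan_rep ::
  "('g, 'x) monoid_scheme \<Rightarrow> 'g \<Rightarrow> 'k::field \<Rightarrow> nat \<Rightarrow> nat \<Rightarrow> 'g \<Rightarrow> 'k mat" where
  "jordan_rep G a \<xi> r i g = jordan_block r (\<xi> ^ i) ^\<^sub>m (LEAST m::nat. a [^]\<^bsub>G\<^esub> m = g)"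

end

theory Submission
  imports
    Defs
    "Jordan_Normal_Form.Jordan_Normal_Form_Existence"
    "Jordan_Normal_Form.DL_Rank"
    "HOL-Algebra.Exponent"
    "HOL-Algebra.Multiplicative_Group"
begin

text \<open>
  A representation of \<open>C\<^sub>n\<close> is a single operator \<open>A\<close>, the action of the generator \<open>a\<close>, subject
  to \<open>A\<^sup>n = 1\<close>; subrepresentations are the \<open>A\<close>-invariant subspaces, and isomorphisms are the
  invertible linear maps that intertwine the operators. The classification is therefore the Jordan
  normal form, restricted to operators of order dividing \<open>n\<close>.

  \<^item> Over an algebraically closed field every matrix is similar to a sum of Jordan blocks
  (\<open>alg_closed_jordan_nf_exists\<close>). A sum of two or more blocks splits the space
  (\<open>block_diagonal_decomposable\<close>), so in an indecomposable representation the generator acts by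
  exactly one block (\<open>indecomposable_generator_jordan_block\<close>).

  \<^item> The block of size \<open>r\<close> with eigenvalue \<open>c\<close> satisfies \<open>J\<^sup>n = 1\<close> if and only if \<open>c\<^sup>n = 1\<close> and
  \<open>r \<le> p\<^sup>s\<close> (\<open>jordan_block_pow_eq_one_iff\<close>). The superdiagonals of \<open>J\<^sup>n\<close> carry the binomial
  coefficients \<open>n choose d\<close>; these vanish modulo \<open>p\<close> for \<open>0 < d < p\<^sup>s\<close>, and the one with
  \<open>d = p\<^sup>s\<close> does not. Since \<open>x \<mapsto> x\<^sup>p\<close> is injective, \<open>c\<^sup>n = 1\<close> forces \<open>c\<^sup>t = 1\<close>, so that \<open>c\<close> is a
  power of \<open>\<xi>\<close>.

  \<^item> One block is indecomposable, because each nonzero invariant subspace contains the eigenvector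
  \<open>e\<^sub>0\<close> (\<open>jordan_block_invariant_subspace_contains_eigenvector\<close>), and two such subspaces can then not
  meet in zero only.

  \<^item> Size and eigenvalue of a block are invariants of conjugation, the first being the dimension
  (\<open>jordan_block_conjugate_eq\<close>), so distinct parameters give non-isomorphic representations.
\<close>

section \<open>Binomial coefficients and roots of unity in characteristic \<open>p\<close>\<close>

text \<open>From \<open>d * (n choose d) = n * (n - 1 choose (d - 1))\<close>, the power \<open>p\<^sup>s\<close> divides the left-hand side,
  but it is too large to divide \<open>d\<close>.\<close>

lemma prime_dvd_binomial_prime_power_multiple:
  fixes p s t d :: nat
  assumes "prime p" "0 < d" "d < p ^ s"
  shows "p dvd (p ^ s * t choose d)"
proof (rule ccontr)
  assume "\<not> p dvd (p ^ s * t choose d)"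
  hence cop: "coprime (p ^ s) (p ^ s * t choose d)"
    using assms(1) by (simp add: prime_imp_coprime)
  have "d * (p ^ s * t choose d) = p ^ s * t * (p ^ s * t - 1 choose (d - 1))"
    using assms(2) by (rule times_binomial_minus1_eq)
  hence "p ^ s dvd d * (p ^ s * t choose d)"
    by (metis dvd_triv_left mult.assoc)
  hence "p ^ s dvd d" using cop coprime_dvd_mult_left_iff by blast
  thus False using assms(2,3) nat_dvd_not_less by blast
qed

text \<open>Entry \<open>(i, j)\<close> of the \<open>n\<close>-th power is \<open>n choose (j - i)\<close> times a power of \<open>c\<close>. For \<open>r \<le> p\<^sup>s\<close>
  only offsets below \<open>p\<^sup>s\<close> occur above the diagonal and all of these coefficients vanish. For larger
  \<open>r\<close> the entry \<open>(0, p\<^sup>s)\<close> exists, and its coefficient is as divisible by \<open>p\<close> as \<open>t\<close> is, hence not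
  at all.\<close>

lemma jordan_block_pow_eq_one_iff:
  fixes c :: "'k::field"
  assumes char: "CHAR('k) = p" and p: "prime p" and n: "n = p ^ s * t" and t: "\<not> p dvd t"
    and r: "0 < r"
  shows "jordan_block r c ^\<^sub>m n = 1\<^sub>m r \<longleftrightarrow> c ^ n = 1 \<and> r \<le> p ^ s"
proof
  assume L: "jordan_block r c ^\<^sub>m n = 1\<^sub>m r"
  have "(jordan_block r c ^\<^sub>m n) $$ (0,0) = 1" unfolding L using r by simp
  hence ln: "c ^ n = 1" unfolding jordan_block_pow using r by simp
  have "r \<le> p ^ s"
  proof (rule ccontr)
    assume "\<not> r \<le> p ^ s"
    hence rp: "p ^ s < r" by simp
    have ps: "p ^ s \<noteq> 0" using p by auto
    have t0: "t > 0" using t by (auto intro: Nat.gr0I)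
    have "(jordan_block r c ^\<^sub>m n) $$ (0, p ^ s) = 0" unfolding L using rp ps by simp
    hence "of_nat (n choose p ^ s) * c ^ (n - p ^ s) = 0"
      unfolding jordan_block_pow using rp by simp
    moreover have "c \<noteq> 0" using ln ps t0 n by (auto simp: power_0_left split: if_splits)
    ultimately have "of_nat (n choose p ^ s) = (0 :: 'k)" by simp
    hence "p dvd (n choose p ^ s)" using char of_nat_eq_0_iff_char_dvd by blast
    moreover have "n choose p ^ s \<noteq> 0" using n t0 by simp
    ultimately have "\<not> multiplicity p (n choose p ^ s) = 0"
      by (subst prime_elem_multiplicity_eq_zero_iff) (use p in auto)
    moreover have "multiplicity p (n choose p ^ s) = multiplicity p t"
      unfolding n by (rule const_p_fac[OF t0 p])
    ultimately show False using t not_dvd_imp_multiplicity_0 by metis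
  qed
  thus "c ^ n = 1 \<and> r \<le> p ^ s" using ln by blast
next
  assume R: "c ^ n = 1 \<and> r \<le> p ^ s"
  have "of_nat (n choose (j - i)) = (0 :: 'k)" if "i < j" "j < r" for i j
    using prime_dvd_binomial_prime_power_multiple[OF p, of "j - i" s t] that R n char
      of_nat_eq_0_iff_char_dvd by (metis zero_less_diff less_imp_diff_less order_less_le_trans)
  thus "jordan_block r c ^\<^sub>m n = 1\<^sub>m r"
    unfolding jordan_block_pow using R by (intro eq_matI) auto
qed

text \<open>Raising to the power \<open>q = p\<^sup>s\<close> is additive, so \<open>(x\<^sup>t - 1)\<^sup>q = (x\<^sup>t)\<^sup>q - 1 = 0\<close>.\<close>

lemma root_of_unity_order_prime_to_char:
  fixes x :: "'k::field"
  assumes "CHAR('k) = p" and "prime p" and "x ^ (p ^ s * t) = 1"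
  shows "x ^ t = 1"
proof -
  \<comment> \<open>Additivity is applied to \<open>x\<^sup>t = (x\<^sup>t - 1) + 1\<close>, which avoids the sign of \<open>(- 1)\<^sup>q\<close>.\<close>
  have "((x ^ t - 1) + 1) ^ (p ^ s) = (x ^ t - 1) ^ (p ^ s) + 1 ^ (p ^ s)"
    by (rule freshmans_dream') (use assms in auto)
  moreover have "(x ^ t) ^ (p ^ s) = 1" using assms(3) by (simp add: power_mult[symmetric] mult.commute)
  ultimately have "(x ^ t - 1) ^ (p ^ s) = 0" by simp
  thus ?thesis by simp
qed

lemma primitive_root_powers_inj:
  assumes "primitive_root_of_unity t \<xi>"
  shows "inj_on (\<lambda>i. \<xi> ^ i) {0..<t}"
proof -
  note P = assms[unfolded primitive_root_of_unity_def]
  have nz: "\<xi> \<noteq> 0" using P by (metis power_0_left not_less0 zero_neq_one)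
  have "False" if "i < j" "j < t" "\<xi> ^ i = \<xi> ^ j" for i j
  proof -
    have "\<xi> ^ j = \<xi> ^ i * \<xi> ^ (j - i)" using that(1) by (simp add: power_add[symmetric])
    hence "\<xi> ^ (j - i) = 1" using that nz by simp
    thus False using P that by (metis zero_less_diff less_imp_diff_less)
  qed
  thus ?thesis unfolding inj_on_def by (metis atLeastLessThan_iff linorder_neqE_nat)
qed

text \<open>The \<open>t\<close> distinct powers of \<open>\<xi>\<close> already exhaust the at most \<open>t\<close> roots of \<open>X\<^sup>t - 1\<close>.\<close>

lemma root_of_unity_is_power_of_primitive:
  fixes \<xi> :: "'k::field"
  assumes P: "primitive_root_of_unity t \<xi>" and x: "x ^ t = 1"
  shows "\<exists>i<t. x = \<xi> ^ i"
proof -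
  have t: "0 < t" and xt: "\<xi> ^ t = 1" using P unfolding primitive_root_of_unity_def by auto
  let ?q = "Polynomial.monom 1 t + [:-1:] :: 'k poly"
  have deg: "degree ?q = t"
    using t by (subst degree_add_eq_left) (auto simp: degree_monom_eq)
  hence q0: "?q \<noteq> 0" using t by auto
  have roots: "{x. poly ?q x = 0} = {x. x ^ t = 1}" by (auto simp: poly_monom)
  have fin: "finite {x::'k. x ^ t = 1}" using poly_roots_finite[OF q0] unfolding roots .
  have "card {x::'k. x ^ t = 1} \<le> t"
    using card_poly_roots_bound[OF q0] unfolding roots deg .
  also have "t = card ((\<lambda>i. \<xi> ^ i) ` {0..<t})"
    using card_image[OF primitive_root_powers_inj[OF P]] by simp
  finally have le: "card {x::'k. x ^ t = 1} \<le> card ((\<lambda>i. \<xi> ^ i) ` {0..<t})" .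
  have sub: "(\<lambda>i. \<xi> ^ i) ` {0..<t} \<subseteq> {x. x ^ t = 1}"
  proof (rule image_subsetI, rule CollectI)
    fix i
    show "(\<xi> ^ i) ^ t = 1" using xt by (metis power_mult mult.commute power_one)
  qed
  have "(\<lambda>i. \<xi> ^ i) ` {0..<t} = {x. x ^ t = 1}" by (rule card_seteq[OF fin sub le])
  hence "x \<in> (\<lambda>i. \<xi> ^ i) ` {0..<t}" using x by blast
  thus ?thesis by auto
qed

section \<open>Jordan normal form over an algebraically closed field\<close>

text \<open>A change of basis that makes a prescribed nonzero vector the first basis vector; it serves to
  split off an eigenvector in the triangularization below.\<close>

lemma invertible_matrix_with_first_column:
  fixes v :: "'k::field vec"
  assumes v: "v \<in> carrier_vec n" and v0: "v \<noteq> 0\<^sub>v n"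
  obtains W W' where "W \<in> carrier_mat n n" "W' \<in> carrier_mat n n"
    "W * W' = 1\<^sub>m n" "W' * W = 1\<^sub>m n" "col W 0 = v"
proof -
  interpret vec_space "TYPE('k)" n .
  note bc = basis_completion[OF v v0]
  define W where "W = mat_of_cols n (basis_completion v)"
  have W: "W \<in> carrier_mat n n" unfolding W_def using bc(6) by auto
  have n: "n \<noteq> 0" using v v0 by (metis carrier_vecD eq_vecI index_zero_vec(2) less_nat_zero_code)
  have cols: "cols W = basis_completion v"
    unfolding W_def by (rule cols_mat_of_cols) (use bc(2) in auto)
  have "rank W = n"
    by (rule lin_indpt_full_rank[OF W]) (use cols bc in auto)
  hence "det W \<noteq> 0" using det_rank_iff[OF W] by simp
  from det_non_zero_imp_unit[OF W this, of "()"]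
  obtain W' where "W' \<in> carrier_mat n n" "W * W' = 1\<^sub>m n" "W' * W = 1\<^sub>m n"
    unfolding Units_def ring_mat_def by auto
  moreover have "col W 0 = v"
  proof -
    have "col W 0 = cols W ! 0" using W n by simp
    also have "\<dots> = hd (cols W)" using W n by (intro hd_conv_nth[symmetric]) (metis carrier_matD(2) cols_length length_0_conv)
    finally show ?thesis using bc(7) cols by simp
  qed
  ultimately show ?thesis using W that by blast
qed

lemma alg_closed_eigenvector:
  fixes A :: "'k::alg_closed_field mat"
  assumes A: "A \<in> carrier_mat n n" and n: "n \<noteq> 0"
  obtains v e where "v \<in> carrier_vec n" "v \<noteq> 0\<^sub>v n" "A *\<^sub>v v = e \<cdot>\<^sub>v v"
proof -
  have "degree (char_poly A) > 0" using degree_monic_char_poly[OF A] n by simp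
  then obtain e where "poly (char_poly A) e = 0" using alg_closed_imp_poly_has_root by blast
  hence "eigenvalue A e" using eigenvalue_root_char_poly[OF A] by simp
  thus ?thesis using that A unfolding eigenvalue_def eigenvector_def by auto
qed

text \<open>In a basis starting with an eigenvector, the first column vanishes below the diagonal. The
  lower right block is triangularized by induction.\<close>

lemma alg_closed_triangularizable:
  fixes A :: "'k::alg_closed_field mat"
  assumes "A \<in> carrier_mat n n"
  shows "\<exists>B \<in> carrier_mat n n. upper_triangular B \<and> similar_mat A B"
  using assms
proof (induction n arbitrary: A)
  case 0
  thus ?case by (intro bexI[of _ A]) (auto simp: upper_triangular_def similar_mat_refl)
next
  case (Suc n)
  note A = Suc.prems
  obtain v e where v: "v \<in> carrier_vec (Suc n)" "v \<noteq> 0\<^sub>v (Suc n)" and ev: "A *\<^sub>v v = e \<cdot>\<^sub>v v"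
    using alg_closed_eigenvector[OF A] by blast
  obtain W W' where W: "W \<in> carrier_mat (Suc n) (Suc n)" and W': "W' \<in> carrier_mat (Suc n) (Suc n)"
    and WW': "W * W' = 1\<^sub>m (Suc n)" and W'W: "W' * W = 1\<^sub>m (Suc n)" and col: "col W 0 = v"
    using invertible_matrix_with_first_column[OF v] by blast
  define A' where "A' = W' * A * W"
  have A': "A' \<in> carrier_mat (Suc n) (Suc n)" using W W' A unfolding A'_def by auto
  have "W * A' * W' = (W * W') * A * (W * W')"
    unfolding A'_def using W W' A by (simp add: assoc_mult_mat[of _ "Suc n" "Suc n" _ "Suc n" _ "Suc n"])
  also have "\<dots> = A" unfolding WW' using A by simp
  finally have "A = W * A' * W'" by simp
  hence sim: "similar_mat A A'"
    by (intro similar_matI[of _ _ W W' "Suc n"]) (use A A' W W' WW' W'W in auto)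
  have col0: "A' $$ (Suc i, 0) = 0" if "i < n" for i
  proof -
    have "col A' 0 = W' *\<^sub>v (A *\<^sub>v col W 0)"
      unfolding A'_def using W W' A v(1)[folded col]
      by (subst col_mult2[of _ "Suc n" "Suc n" _ "Suc n"])
        (auto intro!: assoc_mult_mat_vec[of _ "Suc n" "Suc n" _ "Suc n"])
    also have "\<dots> = e \<cdot>\<^sub>v (W' *\<^sub>v col W 0)"
      unfolding col ev using v W' by (simp add: mult_mat_vec)
    also have "W' *\<^sub>v col W 0 = col (W' * W) 0"
      using W W' by (subst col_mult2[of _ "Suc n" "Suc n" _ "Suc n"]) auto
    also have "\<dots> = unit_vec (Suc n) 0" unfolding W'W by simp
    finally have "col A' 0 $ Suc i = 0" using that by simp
    thus ?thesis using A' that by simp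
  qed
  obtain A1 A2 A0 A3 where sp: "split_block A' 1 1 = (A1,A2,A0,A3)"
    by (cases "split_block A' 1 1") auto
  have dims: "dim_row A' = 1 + n" "dim_col A' = 1 + n" using A' by auto
  note blk = split_block[OF sp dims]
  have A0: "A0 = 0\<^sub>m n 1"
    using sp col0 A' unfolding split_block_def Let_def by (intro eq_matI) auto
  obtain B where B: "B \<in> carrier_mat n n" "upper_triangular B" "similar_mat A3 B"
    using Suc.IH[OF blk(4)] by blast
  obtain B0 where B0: "B0 \<in> carrier_mat 1 n"
    "similar_mat (four_block_mat A1 A2 (0\<^sub>m n 1) A3) (four_block_mat A1 B0 (0\<^sub>m n 1) B)"
    using similar_mat_four_block_0_ex[OF similar_mat_refl[OF blk(1)] B(3) blk(2) blk(1) blk(4)] by blast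
  have "upper_triangular (four_block_mat A1 B0 (0\<^sub>m n 1) B)"
    by (rule upper_triangular_four_block[OF blk(1) B(1) _ B(2)]) (use blk(1) in auto)
  moreover have "four_block_mat A1 B0 (0\<^sub>m n 1) B \<in> carrier_mat (Suc n) (Suc n)"
    using four_block_carrier_mat[OF blk(1) B(1)] by simp
  moreover have "similar_mat A (four_block_mat A1 B0 (0\<^sub>m n 1) B)"
    using similar_mat_trans[OF sim] B0(2) blk(5) A0 by metis
  ultimately show ?case by blast
qed

lemma alg_closed_jordan_nf_exists:
  fixes A :: "'k::alg_closed_field mat"
  assumes "A \<in> carrier_mat n n"
  shows "\<exists>n_as. jordan_nf A n_as"
proof -
  obtain B where B: "B \<in> carrier_mat n n" "upper_triangular B" "similar_mat A B"
    using alg_closed_triangularizable[OF assms] by blast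
  from triangular_to_jnf_vector[OF B(1,2)] obtain n_as where "jordan_nf B n_as" by blast
  thus ?thesis using B(3) similar_mat_trans unfolding jordan_nf_def by blast
qed

section \<open>Linear maps and coordinates\<close>

lemma linear_map_iff:
  assumes "vectorspace K V" "vectorspace K W"
  shows "linear_map K V W T \<longleftrightarrow> T \<in> carrier V \<rightarrow> carrier W
    \<and> (\<forall>u\<in>carrier V. \<forall>v\<in>carrier V. T (u \<oplus>\<^bsub>V\<^esub> v) = T u \<oplus>\<^bsub>W\<^esub> T v)
    \<and> (\<forall>c\<in>carrier K. \<forall>v\<in>carrier V. T (c \<odot>\<^bsub>V\<^esub> v) = c \<odot>\<^bsub>W\<^esub> T v)"
  using assms
  unfolding linear_map_def mod_hom_def mod_hom_axioms_def LinearCombinations.module_hom_def vectorspace_def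
  by blast

lemma fin_dim_module_vec: "vectorspace.fin_dim class_ring (module_vec TYPE('k::field) r)"
proof -
  interpret vec_space "TYPE('k)" r .
  show ?thesis by (rule fin_dim)
qed

lemma linear_map_mat:
  fixes A :: "'k::field mat"
  assumes "A \<in> carrier_mat m n"
  shows "linear_map class_ring (module_vec TYPE('k) n) (module_vec TYPE('k) m) ((*\<^sub>v) A)"
  unfolding linear_map_iff[OF vec_vs vec_vs] module_vec_simps
  using assms by (auto simp: mult_add_distrib_mat_vec mult_mat_vec)

lemma linear_map_compose:
  assumes S: "linear_map K U V S" and T: "linear_map K V W T"
  shows "linear_map K U W (\<lambda>u. T (S u))"
proof -
  interpret S: linear_map K U V S by fact
  interpret T: linear_map K V W T by fact
  show ?thesis
    unfolding linear_map_iff[OF S.V.vectorspace_axioms T.W.vectorspace_axioms]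
    using S.T_im T.T_im by (auto simp: Pi_def)
qed

lemma inv_into_linear_map:
  assumes T: "linear_map K V W T" and bij: "bij_betw T (carrier V) (carrier W)"
  shows "linear_map K W V (inv_into (carrier V) T)"
proof -
  interpret linear_map K V W T by fact
  let ?I = "inv_into (carrier V) T"
  have im: "T ` carrier V = carrier W" using bij by (rule bij_betw_imp_surj_on)
  have I: "?I x \<in> carrier V" "T (?I x) = x" if "x \<in> carrier W" for x
    using inv_into_into[of x T "carrier V"] f_inv_into_f[of x T "carrier V"] that im by auto
  have IT: "?I (T v) = v" if "v \<in> carrier V" for v
    using bij_betw_inv_into_left[OF bij that] .
  show ?thesis
    unfolding linear_map_iff[OF W.vectorspace_axioms V.vectorspace_axioms]
  proof (intro conjI ballI)
    show "?I \<in> carrier W \<rightarrow> carrier V" using I by blast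
  next
    fix x y assume xy: "x \<in> carrier W" "y \<in> carrier W"
    have "T (?I x \<oplus>\<^bsub>V\<^esub> ?I y) = x \<oplus>\<^bsub>W\<^esub> y" using T_add I xy by simp
    thus "?I (x \<oplus>\<^bsub>W\<^esub> y) = ?I x \<oplus>\<^bsub>V\<^esub> ?I y"
      using IT[of "?I x \<oplus>\<^bsub>V\<^esub> ?I y"] I xy by simp
  next
    fix c x assume cx: "c \<in> carrier K" "x \<in> carrier W"
    have "T (c \<odot>\<^bsub>V\<^esub> ?I x) = c \<odot>\<^bsub>W\<^esub> x" using T_smult I cx by simp
    thus "?I (c \<odot>\<^bsub>W\<^esub> x) = c \<odot>\<^bsub>V\<^esub> ?I x"
      using IT[of "c \<odot>\<^bsub>V\<^esub> ?I x"] I cx by simp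
  qed
qed

text \<open>Induction on a bound for the support of the vector spares the expansion into a sum over
  unit vectors inside \<open>V\<close>.\<close>

lemma linear_map_eq_on_unit_vecs:
  fixes v :: "'k::field vec"
  assumes S: "linear_map class_ring (module_vec TYPE('k) m) V S"
    and T: "linear_map class_ring (module_vec TYPE('k) m) V T"
    and eq: "\<And>j. j < m \<Longrightarrow> S (unit_vec m j) = T (unit_vec m j)"
    and v: "v \<in> carrier_vec m"
  shows "S v = T v"
proof -
  interpret S: linear_map class_ring "module_vec TYPE('k) m" V S by fact
  interpret T: linear_map class_ring "module_vec TYPE('k) m" V T by fact
  have "S v = T v" if "k \<le> m" "v \<in> carrier_vec m" "\<And>i. k \<le> i \<Longrightarrow> i < m \<Longrightarrow> v $ i = 0" for k v
    using that
  proof (induction k arbitrary: v)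
    case 0
    have "v = 0\<^sub>v m" using 0 by (intro eq_vecI) auto
    thus ?case using S.T0_is_0 T.T0_is_0 unfolding module_vec_simps by metis
  next
    case (Suc k)
    define w where "w = vec m (\<lambda>i. if i = k then 0 else v $ i)"
    have w: "w \<in> carrier_vec m" unfolding w_def by simp
    have k: "k < m" using Suc.prems by simp
    have vw: "v = w + v $ k \<cdot>\<^sub>v unit_vec m k"
      using Suc.prems by (intro eq_vecI) (auto simp: w_def unit_vec_def)
    have "S w = T w"
    proof (rule Suc.IH[OF _ w])
      show "w $ i = 0" if "k \<le> i" "i < m" for i
        using that Suc.prems(3)[of i] unfolding w_def by auto
    qed (use k in simp)
    moreover have "S v = S w \<oplus>\<^bsub>V\<^esub> v $ k \<odot>\<^bsub>V\<^esub> S (unit_vec m k)"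
      using S.T_add[of w "v $ k \<cdot>\<^sub>v unit_vec m k"] S.T_smult[of "v $ k" "unit_vec m k"] w vw
      unfolding module_vec_simps by simp
    moreover have "T v = T w \<oplus>\<^bsub>V\<^esub> v $ k \<odot>\<^bsub>V\<^esub> T (unit_vec m k)"
      using T.T_add[of w "v $ k \<cdot>\<^sub>v unit_vec m k"] T.T_smult[of "v $ k" "unit_vec m k"] w vw
      unfolding module_vec_simps by simp
    ultimately show ?case using eq[OF k] by simp
  qed
  from this[of m v] show ?thesis using v by simp
qed

text \<open>An enumeration of a finite basis \<open>B\<close> turns families of coefficients indexed by \<open>B\<close> into column
  vectors; bijectivity is the uniqueness of coordinates with respect to a basis.\<close>

lemma fin_dim_coordinates:
  fixes V :: "('k::field, 'v, 'z) module_scheme"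
  assumes "vectorspace class_ring V" and fd: "vectorspace.fin_dim class_ring V"
  obtains m T where "linear_map class_ring (module_vec TYPE('k) m) V T"
    "bij_betw T (carrier_vec m) (carrier V)"
proof -
  interpret V: vectorspace class_ring V by fact
  obtain B where fin: "finite B" and basis: "V.basis B" using V.finite_basis_exists[OF fd] by blast
  have B: "B \<subseteq> carrier V" using basis unfolding V.basis_def by blast
  define m where "m = card B"
  obtain b where b: "bij_betw b {0..<m} B"
    using ex_bij_betw_nat_finite[OF fin] unfolding m_def by blast
  define ib where "ib = inv_into {0..<m} b"
  have ib: "ib w < m" "b (ib w) = w" if "w \<in> B" for w
    using bij_betw_inv_into_right[OF b that] bij_betwE[OF bij_betw_inv_into[OF b]] that
    unfolding ib_def by auto
  have bi: "b i \<in> B" "ib (b i) = i" if "i < m" for i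
    using bij_betw_inv_into_left[OF b, of i] bij_betwE[OF b] that unfolding ib_def by auto
  have coord: "\<exists>!c. c \<in> B \<rightarrow>\<^sub>E UNIV \<and> V.lincomb c B = x" if "x \<in> carrier V" for x
    using V.basis_criterion[OF fin B] basis that by simp
  \<comment> \<open>The coefficient of the basis vector with number \<open>i\<close> is \<open>v $ i\<close>.\<close>
  define T where "T v = V.lincomb (\<lambda>w. v $ ib w) B" for v :: "'k vec"
  have cong: "V.lincomb c B = V.lincomb d B" if "\<And>w. w \<in> B \<Longrightarrow> c w = d w" for c d
    by (rule V.lincomb_cong[OF refl B that]) auto
  have carr: "T v \<in> carrier V" for v
    unfolding T_def by (rule V.lincomb_closed[OF B]) auto
  have lin: "linear_map class_ring (module_vec TYPE('k) m) V T"
    unfolding linear_map_iff[OF vec_vs V.vectorspace_axioms] module_vec_simps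
  proof (intro conjI ballI)
    show "T \<in> carrier_vec m \<rightarrow> carrier V" using carr by blast
  next
    fix u v :: "'k vec" assume uv: "u \<in> carrier_vec m" "v \<in> carrier_vec m"
    have "T (u + v) = V.lincomb (\<lambda>w. u $ ib w + v $ ib w) B"
      unfolding T_def by (rule cong) (use uv ib in auto)
    also have "\<dots> = T u \<oplus>\<^bsub>V\<^esub> T v"
      using V.lincomb_sum[OF fin B, of "\<lambda>w. u $ ib w" "\<lambda>w. v $ ib w"] unfolding T_def by simp
    finally show "T (u + v) = T u \<oplus>\<^bsub>V\<^esub> T v" .
  next
    fix c and v :: "'k vec" assume v: "v \<in> carrier_vec m"
    have "T (c \<cdot>\<^sub>v v) = V.lincomb (\<lambda>w. c * v $ ib w) B"
      unfolding T_def by (rule cong) (use v ib in auto)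
    also have "\<dots> = c \<odot>\<^bsub>V\<^esub> T v"
      using V.lincomb_smult[OF B, of "\<lambda>w. v $ ib w" c] unfolding T_def by simp
    finally show "T (c \<cdot>\<^sub>v v) = c \<odot>\<^bsub>V\<^esub> T v" .
  qed
  have inj: "inj_on T (carrier_vec m)"
  proof (rule inj_onI)
    fix u v :: "'k vec" assume uv: "u \<in> carrier_vec m" "v \<in> carrier_vec m" "T u = T v"
    let ?r = "\<lambda>v. restrict (\<lambda>w. v $ ib w) B"
    have "V.lincomb (?r v) B = T v" for v :: "'k vec" unfolding T_def by (rule cong) simp
    moreover have "?r v \<in> B \<rightarrow>\<^sub>E UNIV" for v :: "'k vec" by simp
    ultimately have "?r u = ?r v" using coord[OF carr[of u]] uv(3) by metis
    hence "u $ i = v $ i" if "i < m" for i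
      using bi[OF that] by (metis restrict_apply')
    thus "u = v" using uv by (intro eq_vecI) auto
  qed
  have "x \<in> T ` carrier_vec m" if x: "x \<in> carrier V" for x
  proof -
    obtain c where c: "V.lincomb c B = x" using coord[OF x] by blast
    have "T (vec m (\<lambda>i. c (b i))) = V.lincomb c B"
      unfolding T_def by (rule cong) (use ib in simp)
    thus ?thesis using c by (intro image_eqI[of _ _ "vec m (\<lambda>i. c (b i))"]) auto
  qed
  hence "T ` carrier_vec m = carrier V" using carr by blast
  thus ?thesis using that[OF lin] inj unfolding bij_betw_def by blast
qed

lemma linear_endomorphism_matrix:
  fixes V :: "('k::field, 'v, 'z) module_scheme"
  assumes T: "linear_map class_ring (module_vec TYPE('k) m) V T" "bij_betw T (carrier_vec m) (carrier V)"
    and f: "linear_map class_ring V V f"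
  obtains A where "A \<in> carrier_mat m m" "\<And>v. v \<in> carrier_vec m \<Longrightarrow> T (A *\<^sub>v v) = f (T v)"
proof -
  interpret T: linear_map class_ring "module_vec TYPE('k) m" V T by fact
  interpret f: linear_map class_ring V V f by fact
  let ?I = "inv_into (carrier_vec m) T"
  have Tc: "T v \<in> carrier V" if "v \<in> carrier_vec m" for v using T(2) that bij_betwE by blast
  have I: "?I x \<in> carrier_vec m" "T (?I x) = x" if "x \<in> carrier V" for x
    using bij_betw_inv_into_right[OF T(2) that] bij_betwE[OF bij_betw_inv_into[OF T(2)]] that by auto
  define A where "A = mat_of_cols m (map (\<lambda>j. ?I (f (T (unit_vec m j)))) [0..<m])"
  have A: "A \<in> carrier_mat m m" unfolding A_def by auto
  have "T (A *\<^sub>v v) = f (T v)" if v: "v \<in> carrier_vec m" for v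
  proof (rule linear_map_eq_on_unit_vecs[OF _ _ _ v])
    show "linear_map class_ring (module_vec TYPE('k) m) V (\<lambda>v. T (A *\<^sub>v v))"
      by (rule linear_map_compose[OF linear_map_mat[OF A] T(1)])
    show "linear_map class_ring (module_vec TYPE('k) m) V (\<lambda>v. f (T v))"
      by (rule linear_map_compose[OF T(1) f])
    fix j assume j: "j < m"
    have fT: "f (T (unit_vec m j)) \<in> carrier V" using Tc f.T_im by simp
    have "A *\<^sub>v unit_vec m j = col A j"
      using A j by (intro eq_vecI) auto
    also have "\<dots> = ?I (f (T (unit_vec m j)))"
      unfolding A_def using j I(1)[OF fT] by simp
    finally show "T (A *\<^sub>v unit_vec m j) = f (T (unit_vec m j))" using I(2)[OF fT] by simp
  qed
  thus ?thesis using that A by blast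
qed

section \<open>Invariant subspaces and eigenvalues of a Jordan block\<close>

lemma jordan_block_mult_vec_index:
  fixes v :: "'k::comm_ring_1 vec"
  assumes v: "v \<in> carrier_vec r" and i: "i < r"
  shows "(jordan_block r c *\<^sub>v v) $ i = c * v $ i + (if Suc i < r then v $ Suc i else 0)"
proof -
  have "(jordan_block r c *\<^sub>v v) $ i = (\<Sum>j = 0..<r. jordan_block r c $$ (i, j) * v $ j)"
    using v i by (simp add: scalar_prod_def)
  also have "\<dots> = (\<Sum>j = 0..<r. (if j = i then c * v $ j else 0) + (if j = Suc i then v $ j else 0))"
    using i by (intro sum.cong) auto
  also have "\<dots> = c * v $ i + (if Suc i < r then v $ Suc i else 0)"
    using i by (simp add: sum.distrib)
  finally show ?thesis .
qed

lemma last_nonzero_index: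
  fixes v :: "'k::zero vec"
  assumes v: "v \<in> carrier_vec r" and v0: "v \<noteq> 0\<^sub>v r"
  obtains m where "m < r" "v $ m \<noteq> 0" "\<And>j. m < j \<Longrightarrow> j < r \<Longrightarrow> v $ j = 0"
proof -
  let ?S = "{j. j < r \<and> v $ j \<noteq> 0}"
  have "?S \<noteq> {}"
  proof
    assume "?S = {}"
    hence "v = 0\<^sub>v r" using v by (intro eq_vecI) auto
    thus False using v0 by contradiction
  qed
  moreover have "finite ?S" by simp
  ultimately have m: "Max ?S \<in> ?S" and le: "\<And>j. j \<in> ?S \<Longrightarrow> j \<le> Max ?S"
    by (rule Max_in[rotated], intro Max_ge)
  show ?thesis
  proof (rule that[of "Max ?S"])
    fix j assume "Max ?S < j" "j < r"
    thus "v $ j = 0" using le[of j] by fastforce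
  qed (use m in auto)
qed

lemma subspace_module_vecD:
  assumes "VectorSpace.subspace class_ring U (module_vec TYPE('k::field) r)"
  shows "U \<subseteq> carrier_vec r" "0\<^sub>v r \<in> U" "u \<in> U \<Longrightarrow> w \<in> U \<Longrightarrow> u + w \<in> U" "u \<in> U \<Longrightarrow> c \<cdot>\<^sub>v u \<in> U"
  using assms unfolding VectorSpace.subspace_def submodule_def by (auto simp: module_vec_simps)

text \<open>The nilpotent part \<open>J - c\<close> shifts a vector towards index \<open>0\<close>. Applied as often as the last
  nonzero index of a vector \<open>u\<close> says, it turns \<open>u\<close> into a nonzero multiple of \<open>e\<^sub>0\<close>.\<close>

lemma jordan_block_invariant_subspace_contains_eigenvector:
  fixes U :: "'k::field vec set"
  assumes U: "VectorSpace.subspace class_ring U (module_vec TYPE('k) r)"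
    and inv: "\<And>u. u \<in> U \<Longrightarrow> jordan_block r c *\<^sub>v u \<in> U"
    and nontriv: "U \<noteq> {0\<^sub>v r}"
  shows "unit_vec r 0 \<in> U"
proof -
  note sub = subspace_module_vecD[OF U]
  have *: "unit_vec r 0 \<in> U"
    if "u \<in> U" "m < r" "u $ m \<noteq> 0" "\<And>j. m < j \<Longrightarrow> j < r \<Longrightarrow> u $ j = 0" for u m
    using that
  proof (induction m arbitrary: u)
    case 0
    have u: "u \<in> carrier_vec r" using sub(1) 0 by blast
    have "unit_vec r 0 = inverse (u $ 0) \<cdot>\<^sub>v u"
      using 0 u by (intro eq_vecI) (auto simp: unit_vec_def)
    thus ?case using sub(4)[OF 0(1)] by metis
  next
    case (Suc m)
    have u: "u \<in> carrier_vec r" using sub(1) Suc.prems by blast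
    \<comment> \<open>\<open>w = (J - c) u\<close>, whose last nonzero index is one less than that of \<open>u\<close>.\<close>
    define w where "w = jordan_block r c *\<^sub>v u + (- c) \<cdot>\<^sub>v u"
    have w: "w \<in> U" unfolding w_def using sub(3,4) inv Suc.prems(1) by blast
    have "w $ i = (if Suc i < r then u $ Suc i else 0)" if "i < r" for i
      using that u unfolding w_def by (simp add: jordan_block_mult_vec_index[OF u that] del: index_mult_mat_vec)
    thus ?case using Suc.prems by (intro Suc.IH[OF w]) auto
  qed
  obtain u where u: "u \<in> U" "u \<noteq> 0\<^sub>v r" using nontriv sub(2) by blast
  obtain m where "m < r" "u $ m \<noteq> 0" "\<And>j. m < j \<Longrightarrow> j < r \<Longrightarrow> u $ j = 0"
    using last_nonzero_index[of u r] u sub(1) by blast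
  thus ?thesis using *[OF u(1)] by blast
qed

text \<open>Comparison of both sides at the last nonzero index of \<open>v\<close>, where the superdiagonal does not
  contribute.\<close>

lemma jordan_block_eigenvalue:
  fixes v :: "'k::field vec"
  assumes v: "v \<in> carrier_vec r" "v \<noteq> 0\<^sub>v r" and ev: "jordan_block r c *\<^sub>v v = e \<cdot>\<^sub>v v"
  shows "e = c"
proof -
  obtain m where m: "m < r" "v $ m \<noteq> 0" "\<And>j. m < j \<Longrightarrow> j < r \<Longrightarrow> v $ j = 0"
    using last_nonzero_index[OF v] by blast
  have "e * v $ m = (jordan_block r c *\<^sub>v v) $ m" using ev v m by simp
  also have "\<dots> = c * v $ m" using jordan_block_mult_vec_index[OF v(1) m(1), of c] m(3) by simp
  finally show ?thesis using m by simp
qed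

lemma jordan_block_mult_unit_vec_0:
  assumes "0 < r"
  shows "jordan_block r c *\<^sub>v unit_vec r 0 = (c :: 'k::field) \<cdot>\<^sub>v unit_vec r 0"
  using assms
  by (intro eq_vecI)
    (auto simp: jordan_block_mult_vec_index[OF unit_vec_carrier] simp del: index_mult_mat_vec)

text \<open>The map carries the eigenvector \<open>e\<^sub>0\<close> of the first block to an eigenvector of the second one for
  the same eigenvalue.\<close>

lemma jordan_block_conjugate_eq:
  fixes c c' :: "'k::field"
  assumes T: "linear_map class_ring (module_vec TYPE('k) r) (module_vec TYPE('k) r') T"
      "bij_betw T (carrier_vec r) (carrier_vec r')"
    and comm: "\<And>v. v \<in> carrier_vec r \<Longrightarrow> T (jordan_block r c *\<^sub>v v) = jordan_block r' c' *\<^sub>v T v"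
    and r: "0 < r"
  shows "r = r' \<and> c = c'"
proof
  interpret linear_map class_ring "module_vec TYPE('k) r" "module_vec TYPE('k) r'" T by fact
  have bij: "inj_on T (carrier (module_vec TYPE('k) r))"
    "T ` carrier (module_vec TYPE('k) r) = carrier (module_vec TYPE('k) r')"
    using T(2) unfolding bij_betw_def module_vec_simps by auto
  have "V.dim = W.dim" by (rule dim_eq[OF fin_dim_module_vec bij])
  thus "r = r'" using vec_space.dim_is_n by metis
  have e0: "unit_vec r 0 \<noteq> (0\<^sub>v r :: 'k vec)" using r by simp
  let ?w = "T (unit_vec r 0)"
  have T0: "T (0\<^sub>v r) = 0\<^sub>v r'" using T0_is_0 unfolding module_vec_simps .
  have w: "?w \<in> carrier_vec r'" using T(2) unit_vec_carrier bij_betwE by blast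
  have w0: "?w \<noteq> 0\<^sub>v r'"
    using e0 T0 bij(1) unit_vec_carrier zero_carrier_vec unfolding module_vec_simps inj_on_def by metis
  have "jordan_block r' c' *\<^sub>v ?w = T (c \<cdot>\<^sub>v unit_vec r 0)"
    using comm[OF unit_vec_carrier] jordan_block_mult_unit_vec_0[OF r] by metis
  also have "\<dots> = c \<cdot>\<^sub>v ?w"
    using T_smult[of c "unit_vec r 0"] unfolding module_vec_simps by simp
  finally show "c = c'" by (rule jordan_block_eigenvalue[OF w w0])
qed

section \<open>Representations of a finite cyclic group\<close>

lemma pow_mat_add:
  fixes A :: "'k::semiring_1 mat"
  assumes "A \<in> carrier_mat m m"
  shows "A ^\<^sub>m (k + l) = A ^\<^sub>m k * A ^\<^sub>m l"
proof (induction l)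
  case 0
  thus ?case using assms by simp
next
  case (Suc l)
  thus ?case using assms by (simp add: assoc_mult_mat[of _ m m _ m _ m])
qed

lemma pow_mat_mod:
  fixes A :: "'k::semiring_1 mat"
  assumes A: "A \<in> carrier_mat m m" and An: "A ^\<^sub>m n = 1\<^sub>m m"
  shows "A ^\<^sub>m k = A ^\<^sub>m (k mod n)"
proof -
  have "A ^\<^sub>m (n * q) = 1\<^sub>m m" for q
  proof (induction q)
    case (Suc q)
    thus ?case using pow_mat_add[OF A, of n "n * q"] An by simp
  qed (use A in simp)
  hence "A ^\<^sub>m (n * (k div n) + k mod n) = A ^\<^sub>m (k mod n)"
    using pow_mat_add[OF A, of "n * (k div n)" "k mod n"] A by simp
  thus ?thesis by simp
qed

lemma general_linear_simps:
  "x \<in> carrier (general_linear TYPE('k::field) r) \<longleftrightarrow>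
     x \<in> carrier_mat r r \<and> (\<exists>y\<in>carrier_mat r r. y * x = 1\<^sub>m r \<and> x * y = 1\<^sub>m r)"
  "x \<otimes>\<^bsub>general_linear TYPE('k) r\<^esub> y = x * y"
  "\<one>\<^bsub>general_linear TYPE('k) r\<^esub> = 1\<^sub>m r"
  unfolding general_linear_def units_of_def Units_def ring_mat_simps by auto

lemma group_general_linear: "group (general_linear TYPE('k::field) r)"
proof -
  interpret ring "ring_mat TYPE('k) r ()" by (rule ring_mat)
  show ?thesis unfolding general_linear_def by (rule units_group)
qed

lemma group_rep_mat_action:
  fixes R :: "'g \<Rightarrow> 'k::field mat"
  assumes G: "group G" and R: "R \<in> hom G (general_linear TYPE('k) r)"
  shows "group_rep G class_ring (module_vec TYPE('k) r) (mat_action R)"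
proof -
  have car: "R g \<in> carrier_mat r r" if "g \<in> carrier G" for g
    using hom_in_carrier[OF R that] unfolding general_linear_simps by blast
  have one: "R \<one>\<^bsub>G\<^esub> = 1\<^sub>m r"
    using hom_one[OF R G group_general_linear] unfolding general_linear_simps .
  have mult: "R (g \<otimes>\<^bsub>G\<^esub> h) = R g * R h" if "g \<in> carrier G" "h \<in> carrier G" for g h
    using hom_mult[OF R that] unfolding general_linear_simps .
  show ?thesis
  proof (intro group_rep.intro G vec_vs group_rep_axioms.intro)
    fix g assume "g \<in> carrier G"
    thus "linear_map class_ring (module_vec TYPE('k) r) (module_vec TYPE('k) r) (mat_action R g)"
      using linear_map_mat[OF car] unfolding mat_action_def[abs_def] by simp
  next
    fix v assume "v \<in> carrier (module_vec TYPE('k) r)"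
    thus "mat_action R \<one>\<^bsub>G\<^esub> v = v"
      unfolding mat_action_def one by (simp add: module_vec_simps)
  next
    fix g h v assume "g \<in> carrier G" "h \<in> carrier G" "v \<in> carrier (module_vec TYPE('k) r)"
    thus "mat_action R (g \<otimes>\<^bsub>G\<^esub> h) v = mat_action R g (mat_action R h v)"
      unfolding mat_action_def using mult car by (simp add: module_vec_simps assoc_mult_mat_vec[of _ r r _ r])
  qed
qed

locale cyclic_group = group G for G :: "('g, 'x) monoid_scheme" (structure) +
  fixes a :: 'g and n :: nat
  assumes gen_closed: "a \<in> carrier G"
    and generates: "generate G {a} = carrier G"
    and order_eq: "Coset.order G = n"
    and order_pos: "0 < n"
begin

lemma ord_generator: "ord a = n"
  using generate_pow_card[OF gen_closed] generates order_eq by (simp add: Coset.order_def)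

lemma pow_generator_order: "a [^] n = \<one>"
  using pow_ord_eq_1[OF gen_closed] ord_generator by simp

lemma element_is_power:
  assumes "g \<in> carrier G"
  obtains k :: nat where "g = a [^] k"
  using generate_pow_nat[OF gen_closed] ord_generator order_pos assms generates by auto

lemma pow_generator_eq_iff: "a [^] k = a [^] l \<longleftrightarrow> k mod n = l mod n" for k l :: nat
proof -
  have "a [^] k = a [^] l \<longleftrightarrow> a [^] int k = a [^] int l" by (simp add: int_pow_int)
  also have "\<dots> \<longleftrightarrow> int n dvd int l - int k"
    using int_pow_eq[OF gen_closed] ord_generator by simp
  also have "\<dots> \<longleftrightarrow> int l mod int n = int k mod int n" by (simp add: mod_eq_dvd_iff)
  also have "\<dots> \<longleftrightarrow> l mod n = k mod n" by (metis of_nat_eq_iff zmod_int)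
  finally show ?thesis by auto
qed

text \<open>The representation is defined through the least exponent that yields a given group element. Two
  exponents of the same element agree modulo \<open>n\<close>, so \<open>J\<^sup>n = 1\<close> makes every exponent as good as the
  least one.\<close>

lemma jordan_rep_power:
  fixes \<xi> :: "'k::field"
  assumes Jn: "jordan_block r (\<xi> ^ i) ^\<^sub>m n = 1\<^sub>m r"
  shows "jordan_rep G a \<xi> r i (a [^] k) = jordan_block r (\<xi> ^ i) ^\<^sub>m k"
proof -
  define m where "m = (LEAST m::nat. a [^] m = a [^] k)"
  have "a [^] m = a [^] k" unfolding m_def by (rule LeastI[of _ k]) simp
  hence "m mod n = k mod n" by (simp add: pow_generator_eq_iff)
  thus ?thesis
    unfolding jordan_rep_def m_def[symmetric]
    using pow_mat_mod[OF jordan_block_carrier Jn] by metis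
qed

lemma jordan_rep_hom:
  fixes \<xi> :: "'k::field"
  assumes Jn: "jordan_block r (\<xi> ^ i) ^\<^sub>m n = 1\<^sub>m r"
  shows "jordan_rep G a \<xi> r i \<in> hom G (general_linear TYPE('k) r)"
proof (rule homI)
  let ?J = "jordan_block r (\<xi> ^ i)"
  note add = pow_mat_add[OF jordan_block_carrier[of r "\<xi> ^ i"]]
  fix g assume "g \<in> carrier G"
  then obtain k where g: "g = a [^] (k::nat)" by (rule element_is_power)
  \<comment> \<open>The inverse of \<open>J\<^sup>k\<close> is \<open>J\<close> to the power \<open>k * (n - 1)\<close>.\<close>
  have "?J ^\<^sub>m (k * n) = 1\<^sub>m r"
    using pow_mat_mod[OF jordan_block_carrier Jn, of "k * n"] by simp
  moreover have "k + k * (n - 1) = k * n" "k * (n - 1) + k = k * n"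
    using order_pos by (cases n; simp)+
  ultimately have "?J ^\<^sub>m k * ?J ^\<^sub>m (k * (n - 1)) = 1\<^sub>m r" "?J ^\<^sub>m (k * (n - 1)) * ?J ^\<^sub>m k = 1\<^sub>m r"
    using add by metis+
  thus "jordan_rep G a \<xi> r i g \<in> carrier (general_linear TYPE('k) r)"
    unfolding g jordan_rep_power[OF Jn] general_linear_simps
    by (intro conjI bexI[of _ "?J ^\<^sub>m (k * (n - 1))"]) auto
  fix h assume "h \<in> carrier G"
  then obtain l where h: "h = a [^] (l::nat)" by (rule element_is_power)
  show "jordan_rep G a \<xi> r i (g \<otimes> h) =
      jordan_rep G a \<xi> r i g \<otimes>\<^bsub>general_linear TYPE('k) r\<^esub> jordan_rep G a \<xi> r i h"
    unfolding g h nat_pow_mult[OF gen_closed] jordan_rep_power[OF Jn] general_linear_simps add ..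
qed

lemma action_power:
  assumes "group_rep G K V \<sigma>" and v: "v \<in> carrier V"
  shows "\<sigma> (a [^] k) v = (\<sigma> a ^^ k) v" and "(\<sigma> a ^^ k) v \<in> carrier V"
proof -
  have pow_Suc: "a [^] Suc k = a \<otimes> a [^] k" "a [^] k \<in> carrier G" for k
    using nat_pow_Suc2[OF gen_closed] nat_pow_closed[OF gen_closed] .
  interpret group_rep G K V \<sigma> by fact
  have a_in: "\<sigma> a w \<in> carrier V" if "w \<in> carrier V" for w
  proof -
    interpret linear_map K V V "\<sigma> a" by (rule act_linear[OF gen_closed])
    show ?thesis using that by (rule T_im)
  qed
  have "\<sigma> (a [^] k) v = (\<sigma> a ^^ k) v \<and> (\<sigma> a ^^ k) v \<in> carrier V"
  proof (induction k)
    case 0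
    thus ?case using act_one[OF v] v by simp
  next
    case (Suc k)
    have "\<sigma> (a [^] Suc k) v = \<sigma> a (\<sigma> (a [^] k) v)"
      unfolding pow_Suc(1) by (rule act_mult[OF gen_closed pow_Suc(2) v])
    thus ?case using Suc a_in by simp
  qed
  thus "\<sigma> (a [^] k) v = (\<sigma> a ^^ k) v" "(\<sigma> a ^^ k) v \<in> carrier V" by auto
qed

text \<open>This lemma and the next one reduce statements about the whole group to the operator by which
  the generator acts.\<close>

lemma subrep_iff_generator_invariant:
  assumes "group_rep G K V \<sigma>"
  shows "group_rep.subrep G K V \<sigma> W \<longleftrightarrow> VectorSpace.subspace K W V \<and> (\<forall>w\<in>W. \<sigma> a w \<in> W)"
proof -
  interpret group_rep G K V \<sigma> by fact
  have "\<sigma> g w \<in> W" if W: "VectorSpace.subspace K W V" and inv: "\<forall>w\<in>W. \<sigma> a w \<in> W"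
    and g: "g \<in> carrier G" and w: "w \<in> W" for g w
  proof -
    obtain k where k: "g = a [^] (k::nat)" using element_is_power[OF g] by blast
    have "w \<in> carrier V" using W w unfolding VectorSpace.subspace_def submodule_def by blast
    moreover have "(\<sigma> a ^^ k) w \<in> W" by (induction k) (use w inv in auto)
    ultimately show ?thesis using action_power[OF assms] k by simp
  qed
  thus ?thesis unfolding subrep_def using gen_closed by blast
qed

lemma rep_isomorphicI_generator:
  assumes V: "group_rep G K V \<sigma>" and W: "group_rep G K W \<tau>"
    and T: "linear_map K V W T" "bij_betw T (carrier V) (carrier W)"
    and comm: "\<And>v. v \<in> carrier V \<Longrightarrow> T (\<sigma> a v) = \<tau> a (T v)"
  shows "rep_isomorphic G K V \<sigma> W \<tau>"
proof -
  have "T (\<sigma> g v) = \<tau> g (T v)" if g: "g \<in> carrier G" and v: "v \<in> carrier V" for g v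
  proof -
    obtain k where k: "g = a [^] (k::nat)" using element_is_power[OF g] by blast
    have Tv: "T v \<in> carrier W" using T(2) v bij_betwE by blast
    have "T ((\<sigma> a ^^ k) v) = (\<tau> a ^^ k) (T v)"
    proof (induction k)
      case (Suc k)
      thus ?case using comm[OF action_power(2)[OF V v, of k]] by simp
    qed simp
    thus ?thesis unfolding k using action_power(1)[OF V v] action_power(1)[OF W Tv] by simp
  qed
  thus ?thesis unfolding rep_isomorphic_def using T by blast
qed

end

lemma (in cyclic_group) jordan_rep_indecomposable:
  fixes \<xi> :: "'k::field"
  assumes Jn: "jordan_block r (\<xi> ^ i) ^\<^sub>m n = 1\<^sub>m r" and r: "0 < r"
  shows "indecomposable_rep G class_ring (module_vec TYPE('k) r) (mat_action (jordan_rep G a \<xi> r i))"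
proof -
  let ?V = "module_vec TYPE('k) r"
  let ?\<sigma> = "mat_action (jordan_rep G a \<xi> r i)"
  have rep: "group_rep G class_ring ?V ?\<sigma>"
    by (rule group_rep_mat_action[OF is_group jordan_rep_hom[OF Jn]])
  interpret group_rep G class_ring ?V ?\<sigma> by (rule rep)
  have act: "?\<sigma> a v = jordan_block r (\<xi> ^ i) *\<^sub>v v" for v
    using jordan_rep_power[OF Jn, of 1] gen_closed unfolding mat_action_def by simp
  have e0: "unit_vec r 0 \<noteq> (0\<^sub>v r :: 'k vec)" using r by simp
  have "unit_vec r 0 \<in> U" if "subrep U" "U \<noteq> {0\<^sub>v r}" for U
    using that unfolding subrep_iff_generator_invariant[OF rep] act
    by (intro jordan_block_invariant_subspace_contains_eigenvector) auto
  hence "U = {0\<^sub>v r} \<or> W = {0\<^sub>v r}" if "subrep U" "subrep W" "U \<inter> W = {0\<^sub>v r}" for U W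
    using that e0 by blast
  moreover have "carrier ?V \<noteq> {0\<^sub>v r}"
    using e0 unit_vec_carrier unfolding module_vec_simps by blast
  ultimately have indecomposable
    unfolding indecomposable_def module_vec_simps by blast
  thus ?thesis using rep unfolding indecomposable_rep_def by blast
qed

section \<open>Indecomposable representations come from single Jordan blocks\<close>

lemma linear_map_append_zero:
  "linear_map class_ring (module_vec TYPE('k::field) r) (module_vec TYPE('k) (r + s)) (\<lambda>u. u @\<^sub>v 0\<^sub>v s)"
  "linear_map class_ring (module_vec TYPE('k::field) s) (module_vec TYPE('k) (r + s)) (\<lambda>w. 0\<^sub>v r @\<^sub>v w)"
proof -
  have "c \<cdot>\<^sub>v (u @\<^sub>v w) = c \<cdot>\<^sub>v u @\<^sub>v c \<cdot>\<^sub>v w" for c :: 'k and u w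
    by (intro eq_vecI) auto
  thus "linear_map class_ring (module_vec TYPE('k) r) (module_vec TYPE('k) (r + s)) (\<lambda>u. u @\<^sub>v 0\<^sub>v s)"
    "linear_map class_ring (module_vec TYPE('k) s) (module_vec TYPE('k) (r + s)) (\<lambda>w. 0\<^sub>v r @\<^sub>v w)"
    unfolding linear_map_iff[OF vec_vs vec_vs] module_vec_simps
    by (auto simp: append_vec_add[of _ r _ _ s])
qed

context cyclic_group
begin

text \<open>The two summands are the images under \<open>S\<close> of the vectors supported on the first \<open>r\<close> and on the
  last \<open>s\<close> coordinates.\<close>

lemma block_diagonal_decomposable:
  fixes V :: "('k::field, 'v, 'z) module_scheme"
  assumes rep: "group_rep G class_ring V \<sigma>"
    and S: "linear_map class_ring (module_vec TYPE('k) (r + s)) V S"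
      "bij_betw S (carrier_vec (r + s)) (carrier V)"
    and B: "B \<in> carrier_mat r r" and C: "C \<in> carrier_mat s s"
    and comm: "\<And>v. v \<in> carrier_vec (r + s) \<Longrightarrow>
      S (four_block_mat B (0\<^sub>m r s) (0\<^sub>m s r) C *\<^sub>v v) = \<sigma> a (S v)"
    and r: "0 < r" and s: "0 < s"
  shows "\<not> group_rep.indecomposable G class_ring V \<sigma>"
proof
  assume ind: "group_rep.indecomposable G class_ring V \<sigma>"
  let ?V = "module_vec TYPE('k) (r + s)"
  interpret R: group_rep G class_ring V \<sigma> by fact
  interpret S: linear_map class_ring ?V V S by fact
  define f where "f u = S (u @\<^sub>v 0\<^sub>v s)" for u
  define g where "g w = S (0\<^sub>v r @\<^sub>v w)" for w
  have f: "linear_map class_ring (module_vec TYPE('k) r) V f"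
    unfolding f_def[abs_def] by (rule linear_map_compose[OF linear_map_append_zero(1) S(1)])
  have g: "linear_map class_ring (module_vec TYPE('k) s) V g"
    unfolding g_def[abs_def] by (rule linear_map_compose[OF linear_map_append_zero(2) S(1)])
  interpret f: linear_map class_ring "module_vec TYPE('k) r" V f by fact
  interpret g: linear_map class_ring "module_vec TYPE('k) s" V g by fact
  define U where "U = f ` carrier_vec r"
  define W where "W = g ` carrier_vec s"
  have B0: "B *\<^sub>v 0\<^sub>v r = 0\<^sub>v r" and C0: "C *\<^sub>v 0\<^sub>v s = 0\<^sub>v s"
    using B C by auto
  have "VectorSpace.subspace class_ring U V"
    using f.imT_is_subspace unfolding f.im_def U_def module_vec_simps .
  moreover have "\<sigma> a (f u) = f (B *\<^sub>v u)" if u: "u \<in> carrier_vec r" for u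
    using comm[of "u @\<^sub>v 0\<^sub>v s"] mult_mat_vec_split[OF B C u zero_carrier_vec] u C0
    unfolding f_def by simp
  ultimately have subU: "R.subrep U"
    unfolding subrep_iff_generator_invariant[OF rep] U_def using B by auto
  have "VectorSpace.subspace class_ring W V"
    using g.imT_is_subspace unfolding g.im_def W_def module_vec_simps .
  moreover have "\<sigma> a (g w) = g (C *\<^sub>v w)" if w: "w \<in> carrier_vec s" for w
    using comm[of "0\<^sub>v r @\<^sub>v w"] mult_mat_vec_split[OF B C zero_carrier_vec w] w B0
    unfolding g_def by simp
  ultimately have subW: "R.subrep W"
    unfolding subrep_iff_generator_invariant[OF rep] W_def using C by auto
  have Sinj: "u = v" if "S u = S v" "u \<in> carrier_vec (r + s)" "v \<in> carrier_vec (r + s)" for u v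
    using bij_betw_imp_inj_on[OF S(2)] that unfolding inj_on_def by blast
  have f0: "f (0\<^sub>v r) = \<zero>\<^bsub>V\<^esub>" and g0: "g (0\<^sub>v s) = \<zero>\<^bsub>V\<^esub>"
    using f.T0_is_0 g.T0_is_0 unfolding module_vec_simps by auto
  have int: "U \<inter> W = {\<zero>\<^bsub>V\<^esub>}"
  proof -
    have "f u = \<zero>\<^bsub>V\<^esub>" if "u \<in> carrier_vec r" "w \<in> carrier_vec s" "f u = g w" for u w
    proof -
      have "u @\<^sub>v 0\<^sub>v s = 0\<^sub>v r @\<^sub>v w"
        by (rule Sinj) (use that in \<open>auto simp: f_def g_def\<close>)
      hence "u = 0\<^sub>v r" using append_vec_eq[OF that(1) zero_carrier_vec] by blast
      thus ?thesis using f0 by simp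
    qed
    moreover have "\<zero>\<^bsub>V\<^esub> \<in> U" "\<zero>\<^bsub>V\<^esub> \<in> W"
      unfolding U_def W_def using f0 g0 by (metis imageI zero_carrier_vec)+
    ultimately show ?thesis unfolding U_def W_def by blast
  qed
  have sum: "R.subspace_sum U W = carrier V"
  proof
    show "R.subspace_sum U W \<subseteq> carrier V"
      unfolding R.submodule_sum_def U_def W_def
      using f.T_im g.T_im by (auto simp: module_vec_simps)
    show "carrier V \<subseteq> R.subspace_sum U W"
    proof
      fix x assume "x \<in> carrier V"
      then obtain v where v: "v \<in> carrier_vec (r + s)" "x = S v"
        using bij_betw_imp_surj_on[OF S(2)] by blast
      define u where "u = vec_first v r"
      define w where "w = vec_last v s"
      have uw: "u \<in> carrier_vec r" "w \<in> carrier_vec s" unfolding u_def w_def by auto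
      have "v = u @\<^sub>v w" unfolding u_def w_def using v(1) by simp
      also have "\<dots> = (u @\<^sub>v 0\<^sub>v s) + (0\<^sub>v r @\<^sub>v w)"
        using uw by (subst append_vec_add[of _ r _ _ s]) auto
      finally have "x = f u \<oplus>\<^bsub>V\<^esub> g w"
        using S.T_add[of "u @\<^sub>v 0\<^sub>v s" "0\<^sub>v r @\<^sub>v w"] uw v(2)
        unfolding f_def g_def module_vec_simps by auto
      thus "x \<in> R.subspace_sum U W"
        unfolding R.submodule_sum_def U_def W_def using uw by auto
    qed
  qed
  have "U \<noteq> {\<zero>\<^bsub>V\<^esub>}"
  proof
    assume "U = {\<zero>\<^bsub>V\<^esub>}"
    hence "f (unit_vec r 0) = f (0\<^sub>v r)" using f0 unfolding U_def by auto
    hence "unit_vec r 0 @\<^sub>v 0\<^sub>v s = 0\<^sub>v r @\<^sub>v (0\<^sub>v s :: 'k vec)"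
      by (intro Sinj) (auto simp: f_def)
    hence "unit_vec r 0 = (0\<^sub>v r :: 'k vec)"
      using append_vec_eq[OF unit_vec_carrier zero_carrier_vec] by blast
    thus False using r by simp
  qed
  moreover have "W \<noteq> {\<zero>\<^bsub>V\<^esub>}"
  proof
    assume "W = {\<zero>\<^bsub>V\<^esub>}"
    hence "g (unit_vec s 0) = g (0\<^sub>v s)" using g0 unfolding W_def by auto
    hence "0\<^sub>v r @\<^sub>v unit_vec s 0 = 0\<^sub>v r @\<^sub>v (0\<^sub>v s :: 'k vec)"
      by (intro Sinj) (auto simp: g_def)
    hence "unit_vec s 0 = (0\<^sub>v s :: 'k vec)"
      using append_vec_eq[OF zero_carrier_vec zero_carrier_vec] by blast
    thus False using s by simp
  qed
  ultimately show False
    using ind subU subW int sum unfolding R.indecomposable_def by blast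
qed

text \<open>The matrix of the generator in some coordinates is brought to Jordan normal form. The empty list of
  blocks would give the zero space, and a list with at least two blocks a decomposition.\<close>

lemma indecomposable_generator_jordan_block:
  fixes V :: "('k::alg_closed_field, 'v, 'z) module_scheme"
  assumes rep: "group_rep G class_ring V \<sigma>" and fd: "vectorspace.fin_dim class_ring V"
    and ind: "group_rep.indecomposable G class_ring V \<sigma>"
  shows "\<exists>r c S. 0 < r \<and> linear_map class_ring (module_vec TYPE('k) r) V S
    \<and> bij_betw S (carrier_vec r) (carrier V)
    \<and> (\<forall>v\<in>carrier_vec r. S (jordan_block r c *\<^sub>v v) = \<sigma> a (S v))"
proof -
  interpret R: group_rep G class_ring V \<sigma> by fact
  obtain m T where T: "linear_map class_ring (module_vec TYPE('k) m) V T"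
    "bij_betw T (carrier_vec m) (carrier V)"
    using fin_dim_coordinates[OF R.vectorspace_axioms fd] by blast
  obtain A where A: "A \<in> carrier_mat m m"
    and AT: "\<And>v. v \<in> carrier_vec m \<Longrightarrow> T (A *\<^sub>v v) = \<sigma> a (T v)"
    using linear_endomorphism_matrix[OF T R.act_linear[OF gen_closed]] by blast
  obtain n_as where jnf: "jordan_nf A n_as" using alg_closed_jordan_nf_exists[OF A] by blast
  define J where "J = jordan_matrix n_as"
  obtain P Q where wit: "similar_mat_wit A J P Q"
    using jnf unfolding jordan_nf_def similar_mat_def J_def by blast
  note PQ = similar_mat_witD2[OF A wit]
  define S where "S v = T (P *\<^sub>v v)" for v
  have S: "linear_map class_ring (module_vec TYPE('k) m) V S"
    unfolding S_def[abs_def] by (rule linear_map_compose[OF linear_map_mat[OF PQ(6)] T(1)])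
  have "bij_betw ((*\<^sub>v) P) (carrier_vec m) (carrier_vec m)"
  proof (rule bij_betw_byWitness[where f' = "(*\<^sub>v) Q"])
    show "\<forall>v\<in>carrier_vec m. Q *\<^sub>v (P *\<^sub>v v) = v" "\<forall>v\<in>carrier_vec m. P *\<^sub>v (Q *\<^sub>v v) = v"
      using PQ by (metis assoc_mult_mat_vec one_mult_mat_vec)+
  qed (use PQ in auto)
  hence Sbij: "bij_betw S (carrier_vec m) (carrier V)"
    using bij_betw_trans[OF _ T(2)] unfolding S_def[abs_def] comp_def by blast
  have comm: "S (J *\<^sub>v v) = \<sigma> a (S v)" if v: "v \<in> carrier_vec m" for v
  proof -
    \<comment> \<open>\<open>A = P J Q\<close> with \<open>Q P = 1\<close>.\<close>
    have "A * P = P * J * (Q * P)" unfolding PQ(3)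
      using PQ by (simp add: assoc_mult_mat[of _ m m _ m _ m])
    hence "A * P = P * J" using PQ by simp
    hence "P *\<^sub>v (J *\<^sub>v v) = A *\<^sub>v (P *\<^sub>v v)"
      using PQ A v by (metis assoc_mult_mat_vec)
    thus ?thesis unfolding S_def using AT[of "P *\<^sub>v v"] PQ v by simp
  qed
  have m: "m = sum_list (map fst n_as)"
    using PQ(5) unfolding J_def by (metis carrier_matD(1) jordan_matrix_dim(1))
  show ?thesis
  proof (cases n_as)
    case Nil
    hence "carrier_vec m = {0\<^sub>v m :: 'k vec}" using m by auto
    moreover interpret S: linear_map class_ring "module_vec TYPE('k) m" V S by (rule S)
    have "S (0\<^sub>v m) = \<zero>\<^bsub>V\<^esub>" using S.T0_is_0 unfolding module_vec_simps .
    ultimately have "carrier V = {\<zero>\<^bsub>V\<^esub>}" using bij_betw_imp_surj_on[OF Sbij] by simp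
    thus ?thesis using ind unfolding R.indecomposable_def by blast
  next
    case (Cons rc rest)
    obtain r c where rc: "rc = (r, c)" by fastforce
    have r: "0 < r" using jnf unfolding Cons rc jordan_nf_def by auto
    show ?thesis
    proof (cases rest)
      case Nil
      have "jordan_block r c = J" unfolding J_def Cons rc Nil jordan_matrix_def
        by (intro eq_matI) (auto simp: Let_def)
      moreover have "m = r" unfolding m Cons rc Nil by simp
      ultimately show ?thesis using r S Sbij comm by auto
    next
      case (Cons x xs)
      define s where "s = sum_list (map fst rest)"
      have "fst x \<noteq> 0" using jnf unfolding \<open>n_as = rc # rest\<close> Cons jordan_nf_def by auto
      hence s: "0 < s" unfolding s_def Cons by simp
      have mrs: "m = r + s" unfolding m \<open>n_as = rc # rest\<close> rc s_def by simp
      have J: "J = four_block_mat (jordan_block r c) (0\<^sub>m r s) (0\<^sub>m s r) (jordan_matrix rest)"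
        unfolding J_def \<open>n_as = rc # rest\<close> rc s_def by (rule jordan_matrix_Cons)
      have C: "jordan_matrix rest \<in> carrier_mat s s" unfolding s_def by (rule jordan_matrix_carrier)
      have "\<not> R.indecomposable"
        using S Sbij comm unfolding mrs J
        by (rule block_diagonal_decomposable[OF rep _ _ jordan_block_carrier C _ r s])
      thus ?thesis using ind by contradiction
    qed
  qed
qed

text \<open>The relation \<open>a\<^sup>n = 1\<close> of the group is transported to the matrix along \<open>S\<close>.\<close>

lemma intertwined_matrix_pow_order:
  fixes V :: "('k::field, 'v, 'z) module_scheme"
  assumes rep: "group_rep G class_ring V \<sigma>"
    and S: "bij_betw S (carrier_vec r) (carrier V)" and A: "A \<in> carrier_mat r r"
    and comm: "\<And>v. v \<in> carrier_vec r \<Longrightarrow> S (A *\<^sub>v v) = \<sigma> a (S v)"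
  shows "A ^\<^sub>m n = 1\<^sub>m r"
proof -
  interpret R: group_rep G class_ring V \<sigma> by fact
  have pow: "S (A ^\<^sub>m k *\<^sub>v v) = (\<sigma> a ^^ k) (S v)" if v: "v \<in> carrier_vec r" for k v
  proof (induction k)
    case 0
    thus ?case using A v by simp
  next
    case (Suc k)
    have "A ^\<^sub>m Suc k = A * A ^\<^sub>m k" using pow_mat_add[OF A, of 1 k] A by simp
    hence "A ^\<^sub>m Suc k *\<^sub>v v = A *\<^sub>v (A ^\<^sub>m k *\<^sub>v v)"
      using A v by (simp add: assoc_mult_mat_vec[of _ r r _ r])
    moreover have "A ^\<^sub>m k *\<^sub>v v \<in> carrier_vec r"
      by (rule mult_mat_vec_carrier[OF pow_carrier_mat[OF A] v])
    ultimately show ?case using comm Suc by simp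
  qed
  have fix_vec: "A ^\<^sub>m n *\<^sub>v v = v" if v: "v \<in> carrier_vec r" for v
  proof -
    have Sv: "S v \<in> carrier V" using S v bij_betwE by blast
    have "S (A ^\<^sub>m n *\<^sub>v v) = \<sigma> \<one> (S v)"
      using pow[OF v] action_power(1)[OF rep Sv, of n] pow_generator_order by simp
    also have "\<dots> = S v" using R.act_one[OF Sv] .
    finally show ?thesis
      using inj_onD[OF bij_betw_imp_inj_on[OF S]] mult_mat_vec_carrier[OF pow_carrier_mat[OF A] v] v
      by blast
  qed
  have An: "A ^\<^sub>m n \<in> carrier_mat r r" by (rule pow_carrier_mat[OF A])
  have "(A ^\<^sub>m n) $$ (i, j) = 1\<^sub>m r $$ (i, j)" if ij: "i < r" "j < r" for i j
  proof -
    have "(A ^\<^sub>m n) $$ (i, j) = (A ^\<^sub>m n *\<^sub>v unit_vec r j) $ i" using ij An A by simp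
    thus ?thesis using ij unfolding fix_vec[OF unit_vec_carrier] by simp
  qed
  thus ?thesis using An by (intro eq_matI) auto
qed

end

section \<open>The classification\<close>

theorem theorem3p4:
  fixes G :: "('g, 'x) monoid_scheme" and a :: 'g
    and p s t n :: nat and \<xi> :: "'k::alg_closed_field"
  assumes "CHAR('k) = p" and "odd p"
    and "n = p ^ s * t" and "1 \<le> s" and "\<not> p dvd t"
    and "primitive_root_of_unity t \<xi>"
    and "group G" and "a \<in> carrier G" and "generate G {a} = carrier G" and "Coset.order G = n"
  shows
    "(\<forall>r\<in>{1..p ^ s}. \<forall>i\<in>{0..t - 1}.
        jordan_rep G a \<xi> r i \<in> hom G (general_linear TYPE('k) r) \<and>
        jordan_rep G a \<xi> r i a = jordan_block r (\<xi> ^ i) \<and>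
        fin_dim_rep G class_ring (module_vec TYPE('k) r) (mat_action (jordan_rep G a \<xi> r i)) \<and>
        indecomposable_rep G class_ring (module_vec TYPE('k) r) (mat_action (jordan_rep G a \<xi> r i))) \<and>
     (\<forall>r\<in>{1..p ^ s}. \<forall>i\<in>{0..t - 1}. \<forall>r'\<in>{1..p ^ s}. \<forall>i'\<in>{0..t - 1}.
        (r, i) \<noteq> (r', i') \<longrightarrow>
        \<not> rep_isomorphic G class_ring
            (module_vec TYPE('k) r) (mat_action (jordan_rep G a \<xi> r i))
            (module_vec TYPE('k) r') (mat_action (jordan_rep G a \<xi> r' i'))) \<and>
     card ({1..p ^ s} \<times> {0..t - 1}) = n \<and>
     (\<forall>(V :: ('k, 'v) module) (\<sigma> :: 'g \<Rightarrow> 'v \<Rightarrow> 'v).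
        fin_dim_rep G class_ring V \<sigma> \<and> indecomposable_rep G class_ring V \<sigma> \<longrightarrow>
        (\<exists>r\<in>{1..p ^ s}. \<exists>i\<in>{0..t - 1}.
           rep_isomorphic G class_ring V \<sigma>
             (module_vec TYPE('k) r) (mat_action (jordan_rep G a \<xi> r i))))"
proof -
  note char = assms(1) and n = assms(3) and pt = assms(5) and prim = assms(6)
  \<comment> \<open>A field of odd characteristic has nonzero, hence prime, characteristic.\<close>
  have "0 < CHAR('k)" using char \<open>odd p\<close> by (metis even_zero gr0I)
  hence p: "prime p" using prime_CHAR_semidom char by blast
  have t: "0 < t" and xt: "\<xi> ^ t = 1" using prim unfolding primitive_root_of_unity_def by auto
  have n0: "0 < n" using n t p by (simp add: prime_gt_0_nat)
  interpret cyclic_group G a n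
    using assms(7-10) n0 by (simp add: cyclic_group_def cyclic_group_axioms_def)
  have range_i: "i \<in> {0..t - 1} \<longleftrightarrow> i < t" for i using t by auto
  have Jn: "jordan_block r (\<xi> ^ i) ^\<^sub>m n = 1\<^sub>m r" if "r \<in> {1..p ^ s}" for r i
  proof -
    have "(\<xi> ^ i) ^ n = (\<xi> ^ t) ^ (i * p ^ s)" unfolding n by (simp add: power_mult[symmetric] ac_simps)
    thus ?thesis using jordan_block_pow_eq_one_iff[OF char p n pt, of r "\<xi> ^ i"] xt that by simp
  qed
  have J_gen: "jordan_rep G a \<xi> r i a = jordan_block r (\<xi> ^ i)" if "r \<in> {1..p ^ s}" for r i
    using jordan_rep_power[OF Jn[OF that], of i 1] gen_closed by simp
  have rep: "group_rep G class_ring (module_vec TYPE('k) r) (mat_action (jordan_rep G a \<xi> r i))"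
    if "r \<in> {1..p ^ s}" for r i
    by (rule group_rep_mat_action[OF is_group jordan_rep_hom[OF Jn[OF that]]])
  have family: "jordan_rep G a \<xi> r i \<in> hom G (general_linear TYPE('k) r) \<and>
        jordan_rep G a \<xi> r i a = jordan_block r (\<xi> ^ i) \<and>
        fin_dim_rep G class_ring (module_vec TYPE('k) r) (mat_action (jordan_rep G a \<xi> r i)) \<and>
        indecomposable_rep G class_ring (module_vec TYPE('k) r) (mat_action (jordan_rep G a \<xi> r i))"
    if r: "r \<in> {1..p ^ s}" for r i
    using jordan_rep_hom[OF Jn[OF r]] J_gen[OF r] rep[OF r] fin_dim_module_vec
      jordan_rep_indecomposable[OF Jn[OF r]] r
    unfolding fin_dim_rep_def by auto
  have distinct: "r = r' \<and> i = i'"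
    if r: "r \<in> {1..p ^ s}" "r' \<in> {1..p ^ s}" and i: "i \<in> {0..t - 1}" "i' \<in> {0..t - 1}"
      and iso: "rep_isomorphic G class_ring
            (module_vec TYPE('k) r) (mat_action (jordan_rep G a \<xi> r i))
            (module_vec TYPE('k) r') (mat_action (jordan_rep G a \<xi> r' i'))" for r i r' i'
  proof -
    obtain T where T: "linear_map class_ring (module_vec TYPE('k) r) (module_vec TYPE('k) r') T"
      "bij_betw T (carrier_vec r) (carrier_vec r')"
      and "\<And>g v. g \<in> carrier G \<Longrightarrow> v \<in> carrier_vec r \<Longrightarrow>
        T (mat_action (jordan_rep G a \<xi> r i) g v) = mat_action (jordan_rep G a \<xi> r' i') g (T v)"
      using iso unfolding rep_isomorphic_def module_vec_simps by blast
    from this(3)[OF gen_closed]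
    have "T (jordan_block r (\<xi> ^ i) *\<^sub>v v) = jordan_block r' (\<xi> ^ i') *\<^sub>v T v" if "v \<in> carrier_vec r" for v
      using that unfolding mat_action_def J_gen[OF r(1)] J_gen[OF r(2)] by blast
    from jordan_block_conjugate_eq[OF T this] r have "r = r'" "\<xi> ^ i = \<xi> ^ i'" by auto
    thus ?thesis using primitive_root_powers_inj[OF prim] i unfolding range_i by (auto simp: inj_on_def)
  qed
  have complete: "\<exists>r\<in>{1..p ^ s}. \<exists>i\<in>{0..t - 1}. rep_isomorphic G class_ring V \<sigma>
             (module_vec TYPE('k) r) (mat_action (jordan_rep G a \<xi> r i))"
    if fd: "fin_dim_rep G class_ring V \<sigma>" and ind: "indecomposable_rep G class_ring V \<sigma>"
    for V :: "('k, 'v) module" and \<sigma> :: "'g \<Rightarrow> 'v \<Rightarrow> 'v"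
  proof -
    have V: "group_rep G class_ring V \<sigma>" and fdV: "vectorspace.fin_dim class_ring V"
      and indV: "group_rep.indecomposable G class_ring V \<sigma>"
      using fd ind unfolding fin_dim_rep_def indecomposable_rep_def by auto
    obtain r c S where r0: "0 < r" and S: "linear_map class_ring (module_vec TYPE('k) r) V S"
      and Sbij: "bij_betw S (carrier_vec r) (carrier V)"
      and comm: "\<forall>v\<in>carrier_vec r. S (jordan_block r c *\<^sub>v v) = \<sigma> a (S v)"
      using indecomposable_generator_jordan_block[OF V fdV indV] by blast
    have "jordan_block r c ^\<^sub>m n = 1\<^sub>m r"
      by (rule intertwined_matrix_pow_order[OF V Sbij jordan_block_carrier]) (use comm in blast)
    hence c: "c ^ n = 1" and "r \<le> p ^ s"
      using jordan_block_pow_eq_one_iff[OF char p n pt r0] by auto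
    hence r: "r \<in> {1..p ^ s}" using r0 by simp
    have "c ^ t = 1" using root_of_unity_order_prime_to_char[OF char p] c unfolding n by blast
    then obtain i where i: "i < t" "c = \<xi> ^ i"
      using root_of_unity_is_power_of_primitive[OF prim] by blast
    let ?I = "inv_into (carrier_vec r) S"
    have "rep_isomorphic G class_ring V \<sigma>
        (module_vec TYPE('k) r) (mat_action (jordan_rep G a \<xi> r i))"
    proof (rule rep_isomorphicI_generator[OF V rep[OF r]])
      show "linear_map class_ring V (module_vec TYPE('k) r) ?I"
        using inv_into_linear_map[OF S] Sbij unfolding module_vec_simps by blast
      show "bij_betw ?I (carrier V) (carrier (module_vec TYPE('k) r))"
        using bij_betw_inv_into[OF Sbij] unfolding module_vec_simps .
      fix x assume "x \<in> carrier V"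
      then obtain v where v: "v \<in> carrier_vec r" "x = S v"
        using bij_betw_imp_surj_on[OF Sbij] by blast
      have "?I (\<sigma> a x) = jordan_block r c *\<^sub>v v"
        using comm v bij_betw_inv_into_left[OF Sbij, of "jordan_block r c *\<^sub>v v"]
          mult_mat_vec_carrier[OF jordan_block_carrier v(1), of c] by simp
      also have "v = ?I x" using v bij_betw_inv_into_left[OF Sbij v(1)] by simp
      finally show "?I (\<sigma> a x) = mat_action (jordan_rep G a \<xi> r i) a (?I x)"
        unfolding mat_action_def J_gen[OF r] i(2) .
    qed
    thus ?thesis using r i range_i by blast
  qed
  have "card ({1..p ^ s} \<times> {0..t - 1}) = n" using n t by (simp add: card_cartesian_product)
  moreover have "\<forall>r\<in>{1..p ^ s}. \<forall>i\<in>{0..t - 1}. \<forall>r'\<in>{1..p ^ s}. \<forall>i'\<in>{0..t - 1}.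
      (r, i) \<noteq> (r', i') \<longrightarrow>
      \<not> rep_isomorphic G class_ring
          (module_vec TYPE('k) r) (mat_action (jordan_rep G a \<xi> r i))
          (module_vec TYPE('k) r') (mat_action (jordan_rep G a \<xi> r' i'))"
    using distinct by blast
  ultimately show ?thesis using family complete by (intro conjI) blast+
qed

end
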